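(* Let $a \in \mathbb{C}\setminus\{0\}$, and let $b,c$ be real with $b>0$, $c>0$, $|a|\ne1$, $b\ne1$, $c\ne1$, $b>|a|-1$ and $c>|a|-1$. Let $\beta<1$ and assume that $$\frac{bc}{c-b}\,\Gamma(1-|a|)\left(\left(\frac{2b-1}{b-1}\right)\frac{\Gamma(b)}{\Gamma(1-|a|+b)}-\left(\frac{2c-1}{c-1}\right)\frac{\Gamma(c)}{\Gamma(1-|a|+c)}\right)+\frac{bc}{(|a|-1)(b-1)(c-1)}\le\frac{1}{2(1-\beta)}+1.$$ Then the operator $\mathcal{I}_{a,b,c}$ maps $\mathcal{R}(\beta)$ into $\mathcal{S}_p$; that is, $\mathcal{I}_{a,b,c}(f)\in\mathcal{S}_p$ for every $f\in\mathcal{R}(\beta)$.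
   Context: $\mathbb{D}=\{z\in\mathbb{C}: |z|<1\}$, and $\mathcal{A}$ is the class of functions $f(z)=z+\sum_{n=2}^{\infty}a_nz^n$ analytic in $\mathbb{D}$. $UCV$ is the class of uniformly convex functions, i.e. $f\in\mathcal{A}$ with $\operatorname{Re}\left(1+\frac{zf''(z)}{f'(z)}\right)>\left|\frac{zf''(z)}{f'(z)}\right|$ for $z\in\mathbb{D}$. $\mathcal{S}_p$ is the class of starlike functions $F$ of the form $F(z)=zf'(z)$ with $f\in UCV$; equivalently, $f\in\mathcal{A}$ is in $\mathcal{S}_p$ iff $\left|\frac{zf'(z)}{f(z)}-1\right|<\operatorname{Re}\left(\frac{zf'(z)}{f(z)}\right)$ for $z\in\mathbb{D}$. For $\beta<1$, $\mathcal{R}(\beta)=\{f\in\mathcal{A}: \exists\,\eta\in(-\pi/2,\pi/2) \text{ such that } \operatorname{Re}[e^{i\eta}(f'(z)-\beta)]>0 \text{ for all } z\in\mathbb{D}\}$. The ascending factorial is $(x)_0=1$, $(x)_n=x(x+1)\cdots(x+n-1)$ for $n\ge1$. For $f(z)=z+\sum_{n\ge2}a_nz^n\in\mathcal{A}$, $\mathcal{I}_{a,b,c}(f)(z)=z+\sum_{n=2}^{\infty}A_nz^n$ with $A_n=\frac{(a)_{n-1}(b)_{n-1}(c)_{n-1}}{(b+1)_{n-1}(c+1)_{n-1}(1)_{n-1}}a_n$, i.e. the Hadamard product of $z\,{}_3F_2(a,b,c;b+1,c+1;z)$ with $f$. Convention: the parameters are such that the displayed expression is defined ($b\ne c$, and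 no argument of a Gamma function is a pole).
   Formalization: The formal theorem adds the hypothesis |a|<2 (convergence of the underlying series); without it the claim fails, e.g. for a=5/2, b=2, c=3, β=1/2. *)

theory Defs
  imports "HOL-Analysis.Analysis"
begin

abbreviation unit_disc :: "complex set" where
  "unit_disc \<equiv> ball 0 1"

text \<open>
  Functions on the disc are represented by total functions on the complex plane; their values
  outside the disc are irrelevant in all the classes below.
\<close>

definition class_A :: "(complex \<Rightarrow> complex) set" where
  "class_A = {f. f holomorphic_on unit_disc \<and> f 0 = 0 \<and> deriv f 0 = 1}"

definition taylor_coeff :: "(complex \<Rightarrow> complex) \<Rightarrow> nat \<Rightarrow> complex" where
  "taylor_coeff f n = (deriv ^^ n) f 0 / fact n"

text \<open>
  The condition \<open>deriv f z \<noteq> 0\<close> makes the quotient meaningful: division by zero yields 0 in HOL,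
  so that the inequality alone would hold spuriously at a critical point.
\<close>

definition UCV :: "(complex \<Rightarrow> complex) set" where
  "UCV = {f \<in> class_A. \<forall>z\<in>unit_disc. deriv f z \<noteq> 0 \<and>
     Re (1 + z * deriv (deriv f) z / deriv f z) > cmod (z * deriv (deriv f) z / deriv f z)}"

text \<open>
  Starlike functions in the geometric sense: univalent, with image star-shaped with respect to
  the origin.
\<close>

definition starlike_class :: "(complex \<Rightarrow> complex) set" where
  "starlike_class = {F \<in> class_A. inj_on F unit_disc \<and>
     (\<forall>w \<in> F ` unit_disc. closed_segment 0 w \<subseteq> F ` unit_disc)}"

definition class_Sp :: "(complex \<Rightarrow> complex) set" where
  "class_Sp = {F \<in> starlike_class. \<exists>f\<in>UCV. \<forall>z\<in>unit_disc. F z = z * deriv f z}"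

definition class_R :: "real \<Rightarrow> (complex \<Rightarrow> complex) set" where
  "class_R \<beta> = {f \<in> class_A. \<exists>\<eta>::real. -(pi/2) < \<eta> \<and> \<eta> < pi/2 \<and>
     (\<forall>z\<in>unit_disc. Re (exp (\<i> * of_real \<eta>) * (deriv f z - of_real \<beta>)) > 0)}"

text \<open>The summation index is shifted: the term with index \<open>n\<close> is the one of degree \<open>n + 2\<close>.\<close>

definition I_op :: "complex \<Rightarrow> complex \<Rightarrow> complex \<Rightarrow> (complex \<Rightarrow> complex) \<Rightarrow> complex \<Rightarrow> complex" where
  "I_op a b c f z = z + (\<Sum>n.
     (pochhammer a (n+1) * pochhammer b (n+1) * pochhammer c (n+1)) /
     (pochhammer (b+1) (n+1) * pochhammer (c+1) (n+1) * pochhammer 1 (n+1))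
     * taylor_coeff f (n+2) * z ^ (n+2))"

end

theory Submission
  imports Defs "HOL-Complex_Analysis.Complex_Analysis"
begin

text \<open>
  Caratheodory's inequality gives \<open>\<bar>a\<^sub>n\<bar> \<le> 2 (1 - \<beta>) / n\<close> for the coefficients of a function in
  \<open>R(\<beta>)\<close>, and \<open>\<Sum>n\<ge>2. (2 n - 1) \<bar>A\<^sub>n\<bar> \<le> 1\<close> is sufficient for \<open>S\<^sub>p\<close>, because it forces
  \<open>\<bar>z F' / F - 1\<bar> < 1/2\<close>. With \<open>\<bar>(a)\<^sub>k\<bar> \<le> (\<bar>a\<bar>)\<^sub>k\<close> and \<open>n = k + 1\<close>, this coefficient condition follows
  from a bound on \<open>\<Sum>k\<ge>1. (2 k + 1) / (k + 1) (\<bar>a\<bar>)\<^sub>k / k! b c / ((b + k) (c + k))\<close>. Partial fractions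
  reduce the series to the Beta integrals \<open>\<Sum>\<^sub>k (\<alpha>)\<^sub>k / (k! (x + k)) = B(x, 1 - \<alpha>)\<close> at \<open>x = b, c, 1\<close>,
  which turns the bound into the hypothesis on Gamma functions (the term \<open>k = 0\<close> is the summand 1 on
  its right-hand side).
\<close>

subsection \<open>Coefficients of functions with positive real part\<close>

text \<open>With the circle parametrised by [0,1] one has dz = 2 \<pi> i z dt, so Cauchy's formula
  for the \<open>k\<close>-th derivative becomes a mean value over the circle.\<close>

lemma mean_value_circle:
  fixes p :: "complex \<Rightarrow> complex"
  assumes p: "p holomorphic_on unit_disc" and r: "0 < r" "r < 1"
  shows "((\<lambda>t. p (circlepath 0 r t) / circlepath 0 r t ^ k) has_integral (deriv ^^ k) p 0 / fact k) {0..1}"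
proof -
  have cont: "continuous_on (cball 0 r) p"
    by (rule continuous_on_subset[OF holomorphic_on_imp_continuous_on[OF p]]) (use r in auto)
  have hol: "p holomorphic_on ball 0 r"
    by (rule holomorphic_on_subset[OF p]) (use r in auto)
  have nz: "circlepath 0 r t \<noteq> 0" for t
    using r by (simp add: circlepath)
  have "((\<lambda>t. p (circlepath 0 r t) / circlepath 0 r t ^ Suc k * vector_derivative (circlepath 0 r) (at t))
      has_integral (2 * pi * \<i>) / fact k * (deriv ^^ k) p 0) {0..1}"
    using Cauchy_has_contour_integral_higher_derivative_circlepath[OF cont hol, of 0 k] r
    by (simp add: has_contour_integral)
  also have "(\<lambda>t. p (circlepath 0 r t) / circlepath 0 r t ^ Suc k * vector_derivative (circlepath 0 r) (at t))
     = (\<lambda>t. (2 * pi * \<i>) * (p (circlepath 0 r t) / circlepath 0 r t ^ k))"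
  proof
    fix t
    have "vector_derivative (circlepath 0 r) (at t) = 2 * pi * \<i> * circlepath 0 r t"
      unfolding vector_derivative_circlepath by (simp add: circlepath)
    then show "p (circlepath 0 r t) / circlepath 0 r t ^ Suc k * vector_derivative (circlepath 0 r) (at t)
      = (2 * pi * \<i>) * (p (circlepath 0 r t) / circlepath 0 r t ^ k)"
      using nz[of t] by simp
  qed
  finally have "((\<lambda>t. (2 * pi * \<i>) * (p (circlepath 0 r t) / circlepath 0 r t ^ k))
      has_integral (2 * pi * \<i>) / fact k * (deriv ^^ k) p 0) {0..1}" .
  from has_integral_mult_right[OF this, of "1 / (2 * pi * \<i>)"] show ?thesis
    by (simp add: field_simps)
qed

text \<open>The mean of \<open>cnj p / z ^ k\<close> over a circle vanishes, so the coefficient is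
  also the mean of \<open>2 * Re p / z ^ k\<close>. As \<open>Re p\<close> is positive, its modulus
  is at most \<open>r ^ (-k)\<close> times the mean of \<open>2 * Re p\<close>, which is
  \<open>2 * Re (p 0)\<close>. Then r tends to 1.\<close>

lemma caratheodory_coeff_bound:
  fixes p :: "complex \<Rightarrow> complex"
  assumes p: "p holomorphic_on unit_disc" and pos: "\<And>z. z \<in> unit_disc \<Longrightarrow> Re (p z) > 0"
    and k: "k > 0"
  shows "norm ((deriv ^^ k) p 0 / fact k) \<le> 2 * Re (p 0)"
proof -
  define c where "c = (deriv ^^ k) p 0 / fact k"
  have bound: "norm c * r ^ k \<le> 2 * Re (p 0)" if r: "0 < r" "r < 1" for r
  proof -
    let ?g = "circlepath 0 r"
    have ng: "norm (?g t) = r" for t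
      using r by (simp add: circlepath norm_mult)
    have gd: "?g t \<in> unit_disc" for t using ng[of t] r by simp
    have nz: "?g t \<noteq> 0" for t using ng[of t] r by auto
    \<comment> \<open>As \<open>k > 0\<close>, the function \<open>z ^ k * p z\<close> vanishes at
      0, hence so does its mean.\<close>
    have "((\<lambda>t. ?g t ^ k * p (?g t)) has_integral 0) {0..1}"
      using mean_value_circle[OF holomorphic_on_mult[OF holomorphic_on_power[OF holomorphic_on_ident, of k] p] r, of 0] k
      by (simp add: zero_power)
    then have "((\<lambda>t. cnj (?g t ^ k * p (?g t))) has_integral 0) {0..1}"
      by (subst has_integral_cnj[symmetric]) (simp only: o_def complex_cnj_cnj complex_cnj_zero)
    \<comment> \<open>On the circle \<open>r ^ 2\<close> is z times its conjugate, so this factor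
      turns \<open>cnj z ^ k\<close> into \<open>1 / z ^ k\<close>.\<close>
    from has_integral_mult_right[OF this, of "1 / (of_real r ^ 2) ^ k"]
    have "((\<lambda>t. 1 / (of_real r ^ 2) ^ k * cnj (?g t ^ k * p (?g t))) has_integral 0) {0..1}"
      by simp
    also have "(\<lambda>t. 1 / (of_real r ^ 2) ^ k * cnj (?g t ^ k * p (?g t))) = (\<lambda>t. cnj (p (?g t)) / ?g t ^ k)"
    proof
      fix t
      have "(of_real r ^ 2 :: complex) = ?g t * cnj (?g t)"
        using complex_norm_square[of "?g t"] unfolding ng by simp
      then have "(of_real r ^ 2 :: complex) ^ k = ?g t ^ k * cnj (?g t) ^ k"
        by (simp add: power_mult_distrib)
      then show "1 / (of_real r ^ 2) ^ k * cnj (?g t ^ k * p (?g t)) = cnj (p (?g t)) / ?g t ^ k"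
        using nz[of t] by (simp add: field_simps)
    qed
    finally have "((\<lambda>t. cnj (p (?g t)) / ?g t ^ k) has_integral 0) {0..1}" .
    from has_integral_add[OF mean_value_circle[OF p r, of k] this]
    have 1: "((\<lambda>t. (p (?g t) + cnj (p (?g t))) / ?g t ^ k) has_integral c) {0..1}"
      by (simp add: c_def add_divide_distrib)
    have "((\<lambda>t. p (?g t)) has_integral p 0) {0..1}"
      using mean_value_circle[OF p r, of 0] by simp
    from has_integral_linear[OF this bounded_linear_Re]
    have "((\<lambda>t. Re (p (?g t))) has_integral Re (p 0)) {0..1}" by (simp add: o_def)
    from has_integral_mult_right[OF this, of "2 / r ^ k"]
    have 2: "((\<lambda>t. 2 / r ^ k * Re (p (?g t))) has_integral 2 / r ^ k * Re (p 0)) {0..1}" .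
    have "norm (integral {0..1} (\<lambda>t. (p (?g t) + cnj (p (?g t))) / ?g t ^ k))
        \<le> integral {0..1} (\<lambda>t. 2 / r ^ k * Re (p (?g t)))"
    proof (rule integral_norm_bound_integral)
      fix t
      have "norm (p (?g t) + cnj (p (?g t))) = 2 * Re (p (?g t))"
        using pos[OF gd[of t]] by (simp add: complex_add_cnj)
      then show "norm ((p (?g t) + cnj (p (?g t))) / ?g t ^ k) \<le> 2 / r ^ k * Re (p (?g t))"
        by (simp add: norm_divide norm_power ng)
    qed (use 1 2 in blast)+
    then have "norm c \<le> 2 / r ^ k * Re (p 0)"
      unfolding integral_unique[OF 1] integral_unique[OF 2] .
    then show ?thesis using r by (simp add: field_simps)
  qed
  \<comment> \<open>Only circles of radius below 1 are available, so the factor \<open>r ^ k\<close>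
    is removed in the limit.\<close>
  have "((\<lambda>r. norm c * r ^ k) \<longlongrightarrow> norm c * 1 ^ k) (at_left 1)"
    by (intro tendsto_intros)
  moreover have "\<forall>\<^sub>F r in at_left (1::real). norm c * r ^ k \<le> 2 * Re (p 0)"
    by (rule eventually_at_leftI[of 0]) (use bound in auto)
  ultimately have "norm c * 1 ^ k \<le> 2 * Re (p 0)"
    by (rule tendsto_upperbound) simp
  then show ?thesis by (simp add: c_def)
qed

text \<open>Caratheodory's inequality is applied to
  \<open>exp (\<i> * \<eta>) * (deriv f z - \<beta>)\<close>. The rotation leaves the moduli of its
  coefficients unchanged, and its real part at 0 is cos \<eta> (1 - \<beta>) \<le> 1 - \<beta>.
  Passing from the coefficients of \<open>deriv f\<close> to those of \<open>f\<close> gives the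
  denominator.\<close>

lemma class_R_coeff_bound:
  assumes f: "f \<in> class_R \<beta>" and \<beta>: "\<beta> < 1" and k: "k > 0"
  shows "norm (taylor_coeff f (Suc k)) \<le> 2 * (1 - \<beta>) / (Suc k)"
proof -
  from f obtain \<eta> where hol: "f holomorphic_on unit_disc" and d0: "deriv f 0 = 1"
    and pos: "\<And>z. z \<in> unit_disc \<Longrightarrow> Re (exp (\<i> * of_real \<eta>) * (deriv f z - of_real \<beta>)) > 0"
    unfolding class_R_def class_A_def by blast
  have dhol: "deriv f holomorphic_on unit_disc"
    using hol by (intro holomorphic_intros) auto
  have dk: "(deriv ^^ k) (\<lambda>z. exp (\<i> * of_real \<eta>) * (deriv f z - of_real \<beta>)) 0
      = exp (\<i> * of_real \<eta>) * (deriv ^^ Suc k) f 0"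
  proof -
    have "(deriv ^^ k) (\<lambda>z. exp (\<i> * of_real \<eta>) * (deriv f z - of_real \<beta>)) 0
      = exp (\<i> * of_real \<eta>) * (deriv ^^ k) (\<lambda>z. deriv f z - of_real \<beta>) 0"
      by (rule higher_deriv_cmult[of _ unit_disc]) (use dhol in \<open>auto intro!: holomorphic_intros\<close>)
    also have "(deriv ^^ k) (\<lambda>z. deriv f z - of_real \<beta>) 0 = (deriv ^^ k) (deriv f) 0 - (deriv ^^ k) (\<lambda>z. of_real \<beta>) 0"
      by (rule higher_deriv_diff[of _ unit_disc]) (use dhol in \<open>auto intro!: holomorphic_intros\<close>)
    also have "\<dots> = (deriv ^^ Suc k) f 0"
      using k by (simp add: funpow_swap1)
    finally show ?thesis .
  qed
  have "norm (exp (\<i> * of_real \<eta>) * (deriv ^^ Suc k) f 0 / fact k) \<le> 2 * Re (exp (\<i> * of_real \<eta>) * (deriv f 0 - of_real \<beta>))"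
    using caratheodory_coeff_bound[of "\<lambda>z. exp (\<i> * of_real \<eta>) * (deriv f z - of_real \<beta>)", OF _ pos k] dhol
    unfolding dk by (simp add: holomorphic_intros del: funpow.simps)
  also have "\<dots> = 2 * (cos \<eta> * (1 - \<beta>))"
    by (simp add: d0 Re_exp)
  also have "\<dots> \<le> 2 * (1 - \<beta>)" using \<beta> using mult_right_mono[OF cos_le_one, of "1 - \<beta>" \<eta>] \<beta> by linarith
  finally have "norm ((deriv ^^ Suc k) f 0) / fact k \<le> 2 * (1 - \<beta>)"
    by (simp add: norm_mult norm_divide)
  moreover have "norm (taylor_coeff f (Suc k)) = norm ((deriv ^^ Suc k) f 0) / fact k / Suc k"
    unfolding taylor_coeff_def norm_divide norm_fact by (simp del: funpow.simps add: field_simps)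
  ultimately show ?thesis by (simp only: divide_right_mono of_nat_0_le_iff)
qed

subsection \<open>Summation of the hypergeometric series\<close>

text \<open>The binomial series of \<open>(1 - t) powr (-\<alpha>)\<close> is multiplied by
  \<open>t powr (b - 1)\<close> and integrated term by term over (0,1). The limit is integrable at 1
  because \<alpha> < 1.\<close>

lemma pochhammer_div_sums_Beta:
  fixes \<alpha> b :: real
  assumes \<alpha>: "0 < \<alpha>" "\<alpha> < 1" and b: "b > 0"
  shows "(\<lambda>k. pochhammer \<alpha> k / fact k / (b + real k)) sums Beta b (1 - \<alpha>)"
proof -
  let ?c = "\<lambda>k. pochhammer \<alpha> k / fact k"
  define f where "f = (\<lambda>n t. \<Sum>k<n. ?c k * t powr (b - 1 + real k))"
  let ?g = "\<lambda>t. t powr (b - 1) * (1 - t) powr (1 - \<alpha> - 1)"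
  have c0: "?c k \<ge> 0" for k using \<alpha> by (simp add: pochhammer_nonneg)
  have ser: "(\<lambda>k. ?c k * t powr (b - 1 + real k)) sums ?g t" if t: "t \<in> {0<..<1}" for t
  proof -
    have "(\<lambda>k. ((-\<alpha>) gchoose k) * (-t) ^ k) sums (1 + (-t)) powr (-\<alpha>)"
      by (rule gen_binomial_real) (use t in auto)
    also have "(\<lambda>k. ((-\<alpha>) gchoose k) * (-t) ^ k) = (\<lambda>k. ?c k * t ^ k)"
    proof
      fix k show "((-\<alpha>) gchoose k) * (-t) ^ k = ?c k * t ^ k"
        using power_mult_distrib[of "-1" "-1::real" k]
        by (simp add: gbinomial_pochhammer power_minus[of t])
    qed
    finally have "(\<lambda>k. t powr (b - 1) * (?c k * t ^ k)) sums (t powr (b - 1) * (1 + (-t)) powr (-\<alpha>))"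
      by (rule sums_mult)
    then show ?thesis using t by (simp add: powr_add powr_realpow mult_ac)
  qed
  have int1: "((\<lambda>t. t powr (b - 1 + real k)) has_integral 1 / (b + real k)) {0<..<1}" for k
    using has_integral_powr_from_0[of "b - 1 + real k" 1] b by (simp add: has_integral_Icc_iff_Ioo)
  have intf: "(f n has_integral (\<Sum>k<n. ?c k / (b + real k))) {0<..<1}" for n
  proof -
    have "(f n has_integral (\<Sum>k<n. ?c k * (1 / (b + real k)))) {0<..<1}"
      unfolding f_def by (intro has_integral_sum has_integral_mult_right int1) simp
    then show ?thesis by simp
  qed
  have intg: "(?g has_integral Beta b (1 - \<alpha>)) {0<..<1}"
    using has_integral_Beta_real[of b "1 - \<alpha>"] \<alpha> b by (simp add: has_integral_Icc_iff_Ioo)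
  have "(\<lambda>n. integral {0<..<1} (f n)) \<longlonglongrightarrow> integral {0<..<1} ?g"
  proof (rule dominated_convergence(2))
    \<comment> \<open>The terms are nonnegative, so the limit function itself dominates the partial
      sums.\<close>
    show "norm (f n t) \<le> ?g t" if "t \<in> {0<..<1}" for n t
    proof -
      have "f n t \<ge> 0" unfolding f_def by (intro sum_nonneg mult_nonneg_nonneg c0) auto
      moreover have "f n t \<le> ?g t" unfolding f_def sums_unique[OF ser[OF that]]
        by (rule sum_le_suminf[OF sums_summable[OF ser[OF that]]]) (use c0 in \<open>auto intro!: mult_nonneg_nonneg simp del: times_divide_eq_left\<close>)
      ultimately show ?thesis by simp
    qed
    show "(\<lambda>n. f n t) \<longlonglongrightarrow> ?g t" if "t \<in> {0<..<1}" for t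
      using ser[OF that] unfolding f_def sums_def .
  qed (use intf intg in blast)+
  then show ?thesis
    unfolding sums_def using integral_unique[OF intf] integral_unique[OF intg] by simp
qed

text \<open>For \<open>1 < \<alpha>\<close> the two series diverge separately. Writing
  \<open>(\<alpha>)\<^sub>k = (\<alpha> - 1)\<^sub>k (\<alpha> - 1 + k) / (\<alpha> - 1)\<close> and \<open>(\<alpha> - 1 + k) / (b + k) = 1 + (\<alpha> - 1 - b) / (b + k)\<close>,
  the divergent parts cancel.\<close>
lemma pochhammer_div_diff_sums:
  fixes \<alpha> b d :: real
  assumes \<alpha>: "0 < \<alpha>" "\<alpha> < 2" "\<alpha> \<noteq> 1" and b: "b > 0" "b > \<alpha> - 1" and d: "d > 0" "d > \<alpha> - 1"
  shows "(\<lambda>k. pochhammer \<alpha> k / fact k * (1 / (b + real k) - 1 / (d + real k))) sums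
    (Gamma (1 - \<alpha>) * (Gamma b / Gamma (1 - \<alpha> + b) - Gamma d / Gamma (1 - \<alpha> + d)))"
proof (cases "\<alpha> < 1")
  case True
  from sums_diff[OF pochhammer_div_sums_Beta[OF \<alpha>(1) True b(1)] pochhammer_div_sums_Beta[OF \<alpha>(1) True d(1)]]
  show ?thesis by (simp add: Beta_def algebra_simps)
next
  case False
  with \<alpha> have \<alpha>1: "0 < \<alpha> - 1" "\<alpha> - 1 < 1" by auto
  have G1: "Gamma (2 - \<alpha>) = (1 - \<alpha>) * Gamma (1 - \<alpha>)"
  proof -
    \<comment> \<open>Here 1 - \<alpha> lies strictly between the poles -1 and 0.\<close>
    have "(1 - \<alpha>) \<notin> \<int>\<^sub>\<le>\<^sub>0"
    proof
      assume "(1 - \<alpha>) \<in> \<int>\<^sub>\<le>\<^sub>0"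
      then obtain n where "1 - \<alpha> = - real n" by (elim nonpos_Ints_cases')
      with \<alpha>1 have "0 < real n" "real n < 1" by auto
      then show False by simp
    qed
    from Gamma_plus1[OF this] show ?thesis by (simp add: add.commute)
  qed
  have G2: "Gamma (2 - \<alpha> + x) = (1 - \<alpha> + x) * Gamma (1 - \<alpha> + x)" if "x > \<alpha> - 1" for x
  proof -
    have "1 - \<alpha> + x \<notin> \<int>\<^sub>\<le>\<^sub>0" using that by (auto dest!: nonpos_Ints_nonpos)
    from Gamma_plus1[OF this]
    have "Gamma (1 - \<alpha> + x + 1) = (1 - \<alpha> + x) * Gamma (1 - \<alpha> + x)" .
    moreover have "1 - \<alpha> + x + 1 = 2 - \<alpha> + x" by simp
    ultimately show ?thesis by simp
  qed
  \<comment> \<open>The contribution of x after \<alpha> is lowered to \<alpha> - 1 < 1, where the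
    Beta formula holds with second argument 1 - (\<alpha> - 1) = 2 - \<alpha>.\<close>
  define S where "S = (\<lambda>x. (\<alpha> - 1 - x) / (\<alpha> - 1) * Beta x (2 - \<alpha>))"
  \<comment> \<open>The recurrence of \<open>Gamma\<close> restores the expression from the case
    \<alpha> < 1.\<close>
  have B: "S x = Gamma (1 - \<alpha>) * (Gamma x / Gamma (1 - \<alpha> + x))" if "x > \<alpha> - 1" for x
  proof -
    have *: "Beta x (2 - \<alpha>) = Gamma x * ((1 - \<alpha>) * Gamma (1 - \<alpha>)) / ((1 - \<alpha> + x) * Gamma (1 - \<alpha> + x))"
      unfolding Beta_def G1 using G2[OF that] by (simp add: algebra_simps)
    have "\<alpha> - 1 \<noteq> 0" "1 - \<alpha> + x \<noteq> 0" "Gamma (1 - \<alpha> + x) \<noteq> 0"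
      using that \<alpha> Gamma_real_pos[of "1 - \<alpha> + x"] by linarith+
    then show ?thesis unfolding S_def * by (simp add: divide_simps) (simp add: algebra_simps)
  qed
  have sm: "(\<lambda>k. (\<alpha> - 1 - x) / (\<alpha> - 1) * (pochhammer (\<alpha> - 1) k / fact k / (x + real k))) sums S x"
    if "x > 0" for x
    using sums_mult[OF pochhammer_div_sums_Beta[OF \<alpha>1 that], of "(\<alpha> - 1 - x) / (\<alpha> - 1)"]
    unfolding S_def by (simp add: diff_diff_eq2)
  have eq: "pochhammer \<alpha> k / fact k * (1 / (b + real k) - 1 / (d + real k))
     = (\<alpha> - 1 - b) / (\<alpha> - 1) * (pochhammer (\<alpha> - 1) k / fact k / (b + real k))
     - (\<alpha> - 1 - d) / (\<alpha> - 1) * (pochhammer (\<alpha> - 1) k / fact k / (d + real k))" for k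
  proof -
    have "(\<alpha> - 1) * pochhammer \<alpha> k = pochhammer (\<alpha> - 1) k * (\<alpha> - 1 + real k)"
      using pochhammer_rec[of "\<alpha> - 1" k] pochhammer_rec'[of "\<alpha> - 1" k] by (simp add: mult.commute)
    then have p: "pochhammer \<alpha> k = pochhammer (\<alpha> - 1) k * (\<alpha> - 1 + real k) / (\<alpha> - 1)"
      using \<alpha> by (simp add: field_simps)
    have nz: "\<alpha> - 1 \<noteq> 0" "b + real k \<noteq> 0" "d + real k \<noteq> 0" using \<alpha> b d by auto
    have frac: "(\<alpha> - 1 + real k) * (1 / (b + real k) - 1 / (d + real k))
      = (\<alpha> - 1 - b) / (b + real k) - (\<alpha> - 1 - d) / (d + real k)"
      using nz by (simp add: divide_simps) (simp add: algebra_simps)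
    have "pochhammer \<alpha> k / fact k * (1 / (b + real k) - 1 / (d + real k))
      = pochhammer (\<alpha> - 1) k / fact k / (\<alpha> - 1) * ((\<alpha> - 1 + real k) * (1 / (b + real k) - 1 / (d + real k)))"
      unfolding p by (simp add: mult_ac)
    also have "\<dots> = (\<alpha> - 1 - b) / (\<alpha> - 1) * (pochhammer (\<alpha> - 1) k / fact k / (b + real k))
     - (\<alpha> - 1 - d) / (\<alpha> - 1) * (pochhammer (\<alpha> - 1) k / fact k / (d + real k))"
      unfolding frac by (simp add: algebra_simps)
    finally show ?thesis .
  qed
  show ?thesis
    using sums_diff[OF sm[OF b(1)] sm[OF d(1)]] unfolding eq B[OF b(2)] B[OF d(2)]
    by (simp add: algebra_simps)
qed

text \<open>The terms have order \<open>k powr (\<alpha> - 3)\<close>, so \<alpha> < 2 gives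
  convergence. As a function of k, the rational factor has simple poles at -b, -c and -1 with
  residues adding up to 0. Hence it is a combination of differences against the pole at -1, whose
  series converge for all \<alpha> < 2.\<close>

lemma pochhammer_weighted_sums:
  fixes \<alpha> b c :: real
  assumes \<alpha>: "0 < \<alpha>" "\<alpha> < 2" "\<alpha> \<noteq> 1" and b: "b > 0" "b > \<alpha> - 1" "b \<noteq> 1"
    and c: "c > 0" "c > \<alpha> - 1" "c \<noteq> 1" and bc: "b \<noteq> c"
  shows "(\<lambda>k. (2 * real k + 1) / (real k + 1) * (pochhammer \<alpha> k / fact k * (b * c / ((b + real k) * (c + real k))))) sums
    (b * c / (c - b) * Gamma (1 - \<alpha>) *
           ((2 * b - 1) / (b - 1) * (Gamma b / Gamma (1 - \<alpha> + b))
            - (2 * c - 1) / (c - 1) * (Gamma c / Gamma (1 - \<alpha> + c)))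
         + b * c / ((\<alpha> - 1) * (b - 1) * (c - 1)))"
proof -
  \<comment> \<open>The value B(x, 1 - \<alpha>) written with \<open>Gamma\<close>. For \<alpha> > 1
    the single series diverges and only differences of such values are sums.\<close>
  define g where "g = (\<lambda>x. Gamma (1 - \<alpha>) * (Gamma x / Gamma (1 - \<alpha> + x)))"
  have D: "(\<lambda>k. pochhammer \<alpha> k / fact k * (1 / (x + real k) - 1 / (1 + real k))) sums (g x - g 1)"
    if "x > 0" "x > \<alpha> - 1" for x
    using pochhammer_div_diff_sums[OF \<alpha> that, of 1] \<alpha> by (simp add: g_def algebra_simps)
  have g1: "g 1 = 1 / (1 - \<alpha>)"
  proof -
    have nz: "(1 - \<alpha>) \<notin> \<int>\<^sub>\<le>\<^sub>0"
    proof
      assume "(1 - \<alpha>) \<in> \<int>\<^sub>\<le>\<^sub>0"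
      then obtain n where "1 - \<alpha> = - real n" by (elim nonpos_Ints_cases')
      with \<alpha> have "real n < 1" "real n \<noteq> 0" by linarith+
      then show False by simp
    qed
    from Gamma_plus1[OF nz] Gamma_eq_zero_iff[of "1 - \<alpha>"] nz show ?thesis
      by (simp add: g_def add.commute)
  qed
  \<comment> \<open>The values of the weight (2 x + 1) / (x + 1) at x = -b and x = -c, as they enter
    the residues.\<close>
  let ?B = "(2 * b - 1) / (b - 1)" and ?C = "(2 * c - 1) / (c - 1)"
  have "(\<lambda>k. b * c / (c - b) * (?B * (pochhammer \<alpha> k / fact k * (1 / (b + real k) - 1 / (1 + real k)))
      - ?C * (pochhammer \<alpha> k / fact k * (1 / (c + real k) - 1 / (1 + real k)))))
      sums (b * c / (c - b) * (?B * (g b - g 1) - ?C * (g c - g 1)))"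
    by (intro sums_mult sums_diff D b c)
  also have "(\<lambda>k. b * c / (c - b) * (?B * (pochhammer \<alpha> k / fact k * (1 / (b + real k) - 1 / (1 + real k)))
      - ?C * (pochhammer \<alpha> k / fact k * (1 / (c + real k) - 1 / (1 + real k)))))
    = (\<lambda>k. (2 * real k + 1) / (real k + 1) * (pochhammer \<alpha> k / fact k * (b * c / ((b + real k) * (c + real k)))))"
  proof
    fix k
    define x where "x = real k"
    have nz: "b + x \<noteq> 0" "c + x \<noteq> 0" "1 + x \<noteq> 0" "b - 1 \<noteq> 0" "c - 1 \<noteq> 0" "c - b \<noteq> 0"
      using b c bc by (auto simp: x_def)
    have one: "(2 * y - 1) / (y - 1) * (1 / (y + x) - 1 / (1 + x)) = (1 - 2 * y) / ((y + x) * (1 + x))"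
      if "y + x \<noteq> 0" "y - 1 \<noteq> 0" for y
      using that nz by (simp add: divide_simps) (simp add: algebra_simps)
    have "?B * (1 / (b + x) - 1 / (1 + x)) - ?C * (1 / (c + x) - 1 / (1 + x))
      = (c - b) * (2 * x + 1) / ((b + x) * (c + x) * (1 + x))"
      unfolding one[OF nz(1,4)] one[OF nz(2,5)] using nz
      by (simp add: divide_simps) (simp add: algebra_simps)
    then have key: "b * c / (c - b) * (?B * (1 / (b + x) - 1 / (1 + x)) - ?C * (1 / (c + x) - 1 / (1 + x)))
      = b * c * (2 * x + 1) / ((b + x) * (c + x) * (1 + x))"
      using nz(6) by simp
    have factor: "e * (B * (p * y) - C * (p * z)) = p * (e * (B * y - C * z))" for e B C p y z :: real
      by (simp add: algebra_simps)
    have "b * c / (c - b) * (?B * (p * (1 / (b + x) - 1 / (1 + x))) - ?C * (p * (1 / (c + x) - 1 / (1 + x))))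
      = (2 * x + 1) / (x + 1) * (p * (b * c / ((b + x) * (c + x))))" for p
      unfolding factor key by (simp add: mult_ac add.commute)
    then show "b * c / (c - b) * (?B * (pochhammer \<alpha> k / fact k * (1 / (b + real k) - 1 / (1 + real k)))
      - ?C * (pochhammer \<alpha> k / fact k * (1 / (c + real k) - 1 / (1 + real k))))
      = (2 * real k + 1) / (real k + 1) * (pochhammer \<alpha> k / fact k * (b * c / ((b + real k) * (c + real k))))"
      unfolding x_def .
  qed
  \<comment> \<open>The pole at -1 contributes \<open>(?C - ?B) * g 1\<close>, which is elementary
    because \<open>g 1 = 1 / (1 - \<alpha>)\<close>.\<close>
  also have "b * c / (c - b) * (?B * (g b - g 1) - ?C * (g c - g 1))
     = b * c / (c - b) * (?B * g b - ?C * g c) + b * c / ((\<alpha> - 1) * (b - 1) * (c - 1))"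
  proof -
    have nz: "b - 1 \<noteq> 0" "c - 1 \<noteq> 0" "c - b \<noteq> 0" "1 - \<alpha> \<noteq> 0" "\<alpha> - 1 \<noteq> 0" using \<alpha> b c bc by auto
    have "?C - ?B = (b - c) / ((b - 1) * (c - 1))"
      using nz by (simp add: divide_simps) (simp add: algebra_simps)
    then have "b * c / (c - b) * ((?C - ?B) * g 1) = b * c / ((\<alpha> - 1) * (b - 1) * (c - 1))"
      unfolding g1 using nz by (simp add: divide_simps) (simp add: algebra_simps)
    moreover have "e * (B * (x - z) - C * (y - z)) = e * (B * x - C * y) + e * ((C - B) * z)" for e B C x y z :: real
      by (simp add: algebra_simps)
    ultimately show ?thesis by (simp only:)
  qed
  also have "e * (B * g x - C * g y) = e * Gamma (1 - \<alpha>) *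
      (B * (Gamma x / Gamma (1 - \<alpha> + x)) - C * (Gamma y / Gamma (1 - \<alpha> + y)))" for e B C x y
    by (simp add: g_def algebra_simps)
  finally show ?thesis .
qed

subsection \<open>A coefficient criterion for the class \<open>S\<^sub>p\<close>\<close>

text \<open>The Noshiro-Warschawski criterion. If \<open>F w = F z\<close>, the mean value theorem
  on the segment, applied to \<open>F / (z - w)\<close> so that the increment cancels, gives a point
  where \<open>Re (deriv F u) = 0\<close>.\<close>

lemma Re_deriv_pos_imp_inj_on:
  assumes S: "convex S" "open S" and F: "F holomorphic_on S" and pos: "\<And>z. z \<in> S \<Longrightarrow> Re (deriv F z) > 0"
  shows "inj_on F S"
proof (rule inj_onI, rule ccontr)
  fix w z assume wz: "w \<in> S" "z \<in> S" "F w = F z" "w \<noteq> z"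
  have sub: "closed_segment w z \<subseteq> S"
    using wz S by (simp add: closed_segment_subset)
  have "((\<lambda>u. F u / (z - w)) has_field_derivative (deriv F u / (z - w))) (at u)"
    if "u \<in> closed_segment w z" for u
    using that sub S F by (intro DERIV_cdivide holomorphic_derivI[of _ S]) auto
  from complex_mvt_line[OF this] obtain u where u: "u \<in> closed_segment w z"
    "Re (F z / (z - w)) - Re (F w / (z - w)) = Re (deriv F u / (z - w) * (z - w))" by blast
  then have "Re (deriv F u) = 0" using wz by simp
  with pos[of u] u(1) sub show False by auto
qed

text \<open>By the inverse function, the preimage of \<open>s F(z\<^sub>0)\<close> moves towards the origin as \<open>s\<close> decreases,
  since \<open>F / (z F')\<close> has positive real part. So the closed set of all \<open>s\<close> for which a preimage of
  modulus at most \<open>\<bar>z\<^sub>0\<bar>\<close> exists cannot have a gap.\<close>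
lemma starlike_image:
  assumes F: "F holomorphic_on unit_disc" and inj: "inj_on F unit_disc" and F0: "F 0 = 0"
    and pos: "\<And>z. z \<in> unit_disc \<Longrightarrow> z \<noteq> 0 \<Longrightarrow> Re (F z / (z * deriv F z)) > 0"
    and w0: "w0 \<in> F ` unit_disc"
  shows "closed_segment 0 w0 \<subseteq> F ` unit_disc"
proof -
  from w0 obtain z0 where z0: "z0 \<in> unit_disc" "w0 = F z0" by blast
  let ?K = "cball 0 (norm z0) :: complex set"
  have sub: "?K \<subseteq> unit_disc" using z0 by auto
  obtain g where g: "g holomorphic_on F ` unit_disc"
    "\<And>z. z \<in> unit_disc \<Longrightarrow> deriv F z * deriv g (F z) = 1" "\<And>z. z \<in> unit_disc \<Longrightarrow> g (F z) = z"
    using holomorphic_has_inverse[OF F _ inj] by auto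
  have opn: "open (F ` unit_disc)" by (rule open_mapping_thm3[OF F _ inj]) simp
  define T where "T = (\<lambda>s. of_real s * w0) -` (F ` ?K)"
  have "compact (F ` ?K)"
    by (intro compact_continuous_image continuous_on_subset[OF holomorphic_on_imp_continuous_on[OF F] sub]) auto
  then have clT: "closed T"
    unfolding T_def by (intro continuous_closed_vimage compact_imp_closed) (auto intro!: continuous_intros)
  have left: "\<exists>t\<in>T. s < t \<and> t < u" if u: "u \<in> T" and s: "0 \<le> s" "s < u" for u s
  proof (cases "w0 = 0")
    case True
    then have "T = UNIV" using u by (simp add: T_def split: if_splits)
    then show ?thesis using dense[OF s(2)] by auto
  next
    case False
    from u obtain z where z: "z \<in> ?K" "of_real u * w0 = F z" unfolding T_def by auto
    have zd: "z \<in> unit_disc" using z(1) sub by blast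
    have zn: "z \<noteq> 0" using z(2) False s F0 by auto
    \<comment> \<open>The path of preimages of \<open>s * w0\<close>; its derivative at
      \<open>u\<close> is \<open>z * \<rho> / u\<close>.\<close>
    define \<phi> where "\<phi> = (\<lambda>s. g (of_real s * w0))"
    define \<rho> where "\<rho> = F z / (z * deriv F z)"
    have phiu: "\<phi> u = z" using z(2) g(3)[OF zd] by (simp add: \<phi>_def)
    have gder: "(g has_field_derivative deriv g (F z)) (at (of_real u * w0))"
      unfolding z(2) using zd by (intro holomorphic_derivI[OF g(1) opn]) auto
    have lin: "((\<lambda>s. of_real s * w0) has_vector_derivative w0) (at u)"
      by (rule derivative_eq_intros | simp)+
    have "((g \<circ> (\<lambda>s. of_real s * w0)) has_vector_derivative w0 * deriv g (F z)) (at u)"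
      by (rule field_vector_diff_chain_at[OF lin gder])
    also have "w0 * deriv g (F z) = z * \<rho> / of_real u"
    proof -
      have dn: "deriv F z \<noteq> 0" using g(2)[OF zd] by auto
      have "deriv g (F z) = 1 / deriv F z" using g(2)[OF zd] dn by (simp add: field_simps)
      moreover have "w0 = F z / of_real u" using z(2) s by (simp add: field_simps)
      ultimately show ?thesis using zn by (simp add: \<rho>_def)
    qed
    finally have "(\<phi> has_vector_derivative z * \<rho> / of_real u) (at u)"
      by (simp add: \<phi>_def o_def)
    then have d: "(\<phi> has_derivative (\<lambda>h. h *\<^sub>R (z * \<rho> / of_real u))) (at u)"
      by (simp add: has_vector_derivative_def)
    \<comment> \<open>The derivative of the squared modulus of \<phi> at \<open>u\<close>. Being
      positive, it makes the preimage approach 0 as the parameter decreases.\<close>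
    define v where "v = 2 * (norm z ^ 2 * Re \<rho> / u)"
    have "z \<bullet> (z * \<rho> / of_real u) = norm z ^ 2 * Re \<rho> / u"
      unfolding cmod_power2 inner_complex_def using s by (simp add: field_simps power2_eq_square)
    then have "(\<lambda>h. \<phi> u \<bullet> h *\<^sub>R (z * \<rho> / of_real u) + h *\<^sub>R (z * \<rho> / of_real u) \<bullet> \<phi> u) = (*) v"
      unfolding phiu v_def by (simp add: fun_eq_iff inner_commute[of _ z])
    then have "((\<lambda>s. \<phi> s \<bullet> \<phi> s) has_real_derivative v) (at u)"
      unfolding has_field_derivative_def using has_derivative_inner[OF d d] by simp
    moreover have "v > 0"
      using pos[OF zd zn] zn s by (simp add: v_def \<rho>_def)
    ultimately obtain e where e: "e > 0" "\<And>h. h > 0 \<Longrightarrow> h < e \<Longrightarrow> \<phi> (u - h) \<bullet> \<phi> (u - h) < \<phi> u \<bullet> \<phi> u"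
      using DERIV_pos_inc_left by blast
    \<comment> \<open>Only on the image of F does \<open>g\<close> return a preimage, so
      \<open>u - h\<close> must keep \<open>(u - h) * w0\<close> in that open image.\<close>
    have "open ((\<lambda>s. of_real s * w0) -` (F ` unit_disc) :: real set)"
      by (intro open_vimage opn continuous_intros)
    moreover have "u \<in> (\<lambda>s. of_real s * w0) -` (F ` unit_disc)" using z(2) zd by auto
    ultimately obtain e' where e': "e' > 0" "ball u e' \<subseteq> (\<lambda>s. of_real s * w0) -` (F ` unit_disc)"
      by (meson openE)
    define h where "h = min (min e e') (u - s) / 2"
    have h: "h > 0" "h < e" "h < e'" "h < u - s" using e e' s by (auto simp: h_def min_def)
    have "u - h \<in> ball u e'" using h by (simp add: dist_real_def)
    then obtain z' where z': "z' \<in> unit_disc" "of_real (u - h) * w0 = F z'" using e'(2) by blast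
    have "\<phi> (u - h) = z'" using g(3)[OF z'(1)] z'(2) by (simp add: \<phi>_def)
    with e(2)[OF h(1,2)] phiu have "norm z' < norm z"
      by (simp add: norm_lt)
    then have "u - h \<in> T" using z' z(1) unfolding T_def by (auto intro!: image_eqI[of _ _ z'])
    then show ?thesis using h by (intro bexI[of _ "u - h"]) auto
  qed
  have "s \<in> T" if s: "0 \<le> s" "s \<le> 1" for s
  proof (rule ccontr)
    assume n: "s \<notin> T"
    \<comment> \<open>The least element of this compact set would exceed \<open>s\<close>, and
      \<open>left\<close> then produces a smaller one.\<close>
    let ?U = "T \<inter> {s..1}"
    have "1 \<in> ?U" using s z0 by (auto simp: T_def intro!: image_eqI[of _ _ z0])
    moreover have "compact ?U" using clT by (simp add: closed_Int_compact)
    ultimately obtain u where u: "u \<in> ?U" "\<And>t. t \<in> ?U \<Longrightarrow> u \<le> t"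
      using compact_attains_inf[of ?U] by blast
    have "s < u" using u(1) n by (cases "s = u") auto
    with left[of u s] u(1) s obtain t where "t \<in> T" "s < t" "t < u" by auto
    with u(2)[of t] u(1) show False by auto
  qed
  then show ?thesis
    using sub by (force simp: closed_segment_def T_def scaleR_conv_of_real)
qed

text \<open>Let x = z q' / q. The hypothesis forces \<bar>x\<bar> < 1/2, hence Re (1 + x) > 1/2 >
  \<bar>x\<bar>. A primitive f of q has z f'' / f' = x, so it is in \<open>UCV\<close>; moreover z
  F' / F = 1 + x gives starlikeness, and \<bar>F' - 1\<bar> < 1 gives univalence.\<close>

lemma class_Sp_if_near_identity:
  assumes q: "q holomorphic_on unit_disc" and q0: "q 0 = 1"
    and near: "\<And>z. z \<in> unit_disc \<Longrightarrow> 2 * norm (z * deriv q z) + norm (q z - 1) < 1"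
    and F: "\<And>z. z \<in> unit_disc \<Longrightarrow> F z = z * q z"
  shows "F \<in> class_Sp"
proof -
  have qd: "(q has_field_derivative deriv q z) (at z)" if "z \<in> unit_disc" for z
    using q that by (intro holomorphic_derivI[of _ unit_disc]) auto
  have Fd: "(F has_field_derivative q z + z * deriv q z) (at z)" if z: "z \<in> unit_disc" for z
  proof -
    have "((\<lambda>z. z * q z) has_field_derivative q z + z * deriv q z) (at z)"
      using qd[OF z] by (auto intro!: derivative_eq_intros)
    then show ?thesis
      by (rule has_field_derivative_transform_within_open[of _ _ _ unit_disc]) (use z F in auto)
  qed
  have Fhol: "F holomorphic_on unit_disc"
    using Fd by (meson holomorphic_on_open open_ball)
  have F0: "F 0 = 0" using F[of 0] by simp
  have dF: "deriv F z = q z + z * deriv q z" if "z \<in> unit_disc" for z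
    using Fd[OF that] by (rule DERIV_imp_deriv)
  \<comment> \<open>By the hypothesis \<open>near\<close>, 2 \<bar>z q'\<bar> < 1 - \<bar>q -
    1\<bar> \<le> \<bar>q\<bar>.\<close>
  have lt: "norm (z * deriv q z) < norm (q z) / 2" if z: "z \<in> unit_disc" for z
    using near[OF z] norm_triangle_ineq2[of 1 "1 - q z"] by (simp add: norm_minus_commute)
  have qn: "q z \<noteq> 0" if z: "z \<in> unit_disc" for z
    using lt[OF z] by auto
  define x where "x = (\<lambda>z. z * deriv q z / q z)"
  have x: "norm (x z) < 1/2" if z: "z \<in> unit_disc" for z
    using lt[OF z] qn[OF z] by (simp add: x_def norm_divide divide_simps)
  have xRe: "Re (1 + x z) > 1/2" if z: "z \<in> unit_disc" for z
    using x[OF z] abs_Re_le_cmod[of "x z"] by simp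
  have inj: "inj_on F unit_disc"
  proof (rule Re_deriv_pos_imp_inj_on[OF _ _ Fhol])
    fix z assume z: "z \<in> unit_disc"
    have "norm (z * deriv q z) + norm (q z - 1) < 1" using near[OF z] norm_ge_zero[of "z * deriv q z"] by linarith
    then have "norm (deriv F z - 1) < 1" unfolding dF[OF z]
      using norm_triangle_ineq[of "q z - 1" "z * deriv q z"] by (simp add: algebra_simps)
    then show "Re (deriv F z) > 0" using abs_Re_le_cmod[of "deriv F z - 1"] by simp
  qed auto
  have star: "closed_segment 0 w \<subseteq> F ` unit_disc" if "w \<in> F ` unit_disc" for w
  proof (rule starlike_image[OF Fhol inj F0 _ that])
    fix z :: complex assume z: "z \<in> unit_disc" "z \<noteq> 0"
    have "F z / (z * deriv F z) = inverse (1 + x z)"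
      unfolding F[OF z(1)] dF[OF z(1)] x_def using z(2) qn[OF z(1)] by (simp add: divide_simps)
    moreover have "(Re (1 + x z))\<^sup>2 + (Im (1 + x z))\<^sup>2 > 0"
      using xRe[OF z(1)] by (intro add_pos_nonneg zero_less_power) auto
    ultimately show "Re (F z / (z * deriv F z)) > 0"
      using xRe[OF z(1)] by (simp add: divide_pos_pos)
  qed
  have d01: "deriv F 0 = 1" using dF[of 0] q0 by simp
  obtain h where "\<And>z. z \<in> unit_disc \<Longrightarrow> (h has_field_derivative q z) (at z within unit_disc)"
    using holomorphic_convex_primitive'[OF _ _ q] by auto
  then have h: "(h has_field_derivative q z) (at z)" if "z \<in> unit_disc" for z
    using that by (metis at_within_open open_ball)
  define f where "f = (\<lambda>z. h z - h 0)"
  have fd: "(f has_field_derivative q z) (at z)" if "z \<in> unit_disc" for z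
    unfolding f_def using h[OF that] by (auto intro!: derivative_eq_intros)
  have df: "deriv f z = q z" if "z \<in> unit_disc" for z
    using fd[OF that] by (rule DERIV_imp_deriv)
  have ddf: "deriv (deriv f) z = deriv q z" if z: "z \<in> unit_disc" for z
  proof (rule DERIV_imp_deriv)
    show "(deriv f has_field_derivative deriv q z) (at z)"
      using qd[OF z] by (rule has_field_derivative_transform_within_open[of _ _ _ unit_disc]) (use z df in auto)
  qed
  have "f holomorphic_on unit_disc" using fd by (meson holomorphic_on_open open_ball)
  then have "f \<in> class_A" using df[of 0] q0 by (simp add: class_A_def f_def)
  then have "f \<in> UCV"
    unfolding UCV_def using df ddf qn x xRe by (force simp: x_def)
  moreover have "F \<in> starlike_class"
    unfolding starlike_class_def class_A_def using Fhol F0 d01 inj star by auto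
  ultimately show ?thesis
    unfolding class_Sp_def using F df by (auto intro!: bexI[of _ f])
qed

text \<open>As \<open>u k\<close> belongs to degree n = k + 2, the weight 2 k + 3 is 2 n - 1. For q
  = F / z it splits as 2 (k + 1) + 1, the weights with which \<open>u k\<close> enters 2 \<bar>z
  q'\<bar> and \<bar>q - 1\<bar>.\<close>

lemma class_Sp_if_coeff_sum_le:
  fixes u :: "nat \<Rightarrow> complex"
  assumes sm: "summable (\<lambda>k. (2 * real k + 3) * norm (u k))"
    and le: "(\<Sum>k. (2 * real k + 3) * norm (u k)) \<le> 1"
    and F: "\<And>z. z \<in> unit_disc \<Longrightarrow> F z = z + (\<Sum>k. u k * z ^ (k + 2))"
  shows "F \<in> class_Sp"
proof -
  \<comment> \<open>Splitting off a factor z from q - 1 leaves a factor \<bar>z\<bar> < 1 in the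
    final estimate, which makes the inequality strict although the coefficient sum may equal
    1.\<close>
  define s where "s = (\<lambda>z. \<Sum>k. u k * z ^ k)"
  define q where "q = (\<lambda>z. 1 + z * s z)"
  \<comment> \<open>The choice m = 0 serves s, and m = 1 serves the derivative of q.\<close>
  have nsm: "summable (\<lambda>k. real (m * k + 1) * norm (u k))" if "m \<le> 2" for m
  proof (rule summable_comparison_test'[OF sm])
    fix k
    have "real (m * k + 1) \<le> 2 * real k + 3" using mult_right_mono[OF that, of k] by linarith
    then show "norm (real (m * k + 1) * norm (u k)) \<le> (2 * real k + 3) * norm (u k)"
      by (simp add: mult_right_mono del: of_nat_mult of_nat_add)
  qed
  have psm: "summable (\<lambda>k. norm (of_nat (m * k + 1) * u k * z ^ k))" if "m \<le> 2" "z \<in> unit_disc" for z m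
  proof (rule summable_comparison_test'[OF nsm[OF that(1)]])
    fix k
    show "norm (norm (of_nat (m * k + 1) * u k * z ^ k)) \<le> real (m * k + 1) * norm (u k)"
      using that(2) power_le_one[of "norm z" k]
      unfolding norm_mult norm_power norm_of_nat real_norm_def by (simp add: mult_left_le)
  qed
  have ssm: "(\<lambda>k. u k * z ^ k) sums s z" if z: "z \<in> unit_disc" for z
    using summable_norm_cancel[OF psm[of 0, OF _ z]] by (simp add: s_def summable_sums)
  have shol: "s holomorphic_on unit_disc"
    using power_series_holomorphic[of 0 1 u s] ssm by simp
  have sd: "deriv s z = (\<Sum>k. diffs u k * z ^ k)" if z: "z \<in> unit_disc" for z
    unfolding s_def
    by (rule DERIV_imp_deriv, rule termdiffs_strong'[of 1]) (use z ssm in \<open>auto simp: sums_iff\<close>)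
  have dsm: "summable (\<lambda>k. diffs u k * z ^ k)" if z: "z \<in> unit_disc" for z
    by (rule termdiff_converges[of _ 1]) (use z ssm in \<open>auto simp: sums_iff\<close>)
  have zsd: "(\<lambda>k. of_nat k * u k * z ^ k) sums (z * deriv s z)" if z: "z \<in> unit_disc" for z
  proof -
    have "(\<lambda>k. z * (diffs u k * z ^ k)) sums (z * deriv s z)"
      unfolding sd[OF z] by (intro sums_mult summable_sums dsm z)
    then have "(\<lambda>k. of_nat (Suc k) * u (Suc k) * z ^ Suc k) sums (z * deriv s z)"
      by (simp add: diffs_def mult_ac)
    then show ?thesis by (subst (asm) sums_Suc_iff) simp
  qed
  have qd: "deriv q z = s z + z * deriv s z" if z: "z \<in> unit_disc" for z
  proof (rule DERIV_imp_deriv)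
    have "(s has_field_derivative deriv s z) (at z)"
      using shol z by (intro holomorphic_derivI[of _ unit_disc]) auto
    then show "(q has_field_derivative s z + z * deriv s z) (at z)"
      unfolding q_def by (auto intro!: derivative_eq_intros)
  qed
  show ?thesis
  proof (rule class_Sp_if_near_identity)
    show "q holomorphic_on unit_disc" unfolding q_def by (intro holomorphic_intros shol)
    show "q 0 = 1" by (simp add: q_def)
    show "F z = z * q z" if z: "z \<in> unit_disc" for z
    proof -
      have "(\<lambda>k. z ^ 2 * (u k * z ^ k)) sums (z ^ 2 * s z)" by (intro sums_mult ssm z)
      then have "(\<Sum>k. u k * z ^ (k + 2)) = z ^ 2 * s z"
        by (simp only: sums_iff power_add mult_ac)
      then show ?thesis by (simp add: F[OF z] q_def power2_eq_square algebra_simps)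
    qed
    show "2 * norm (z * deriv q z) + norm (q z - 1) < 1" if z: "z \<in> unit_disc" for z
    proof -
      have 0: "norm (s z) \<le> (\<Sum>k. norm (u k))"
      proof (rule norm_sums_le[OF ssm[OF z] summable_sums])
        show "summable (\<lambda>k. norm (u k))" using nsm[of 0] by simp
        show "norm (u k * z ^ k) \<le> norm (u k)" for k
          using z power_le_one[of "norm z" k] by (simp add: norm_mult norm_power mult_left_le)
      qed
      have 1: "norm (deriv q z) \<le> (\<Sum>k. real (k + 1) * norm (u k))"
      proof (rule norm_sums_le[OF _ summable_sums])
        show "(\<lambda>k. u k * z ^ k + of_nat k * u k * z ^ k) sums deriv q z"
          unfolding qd[OF z] by (intro sums_add ssm zsd z)
        show "summable (\<lambda>k. real (k + 1) * norm (u k))" using nsm[of 1] by simp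
        show "norm (u k * z ^ k + of_nat k * u k * z ^ k) \<le> real (k + 1) * norm (u k)" for k
        proof -
          have "u k * z ^ k + of_nat k * u k * z ^ k = of_nat (k + 1) * u k * z ^ k"
            by (simp add: algebra_simps)
          then have "norm (u k * z ^ k + of_nat k * u k * z ^ k) = real (k + 1) * norm (u k) * norm z ^ k"
            by (simp only: norm_mult norm_power norm_of_nat)
          then show ?thesis
            using z power_le_one[of "norm z" k] by (simp add: mult_left_le)
        qed
      qed
      have "(\<lambda>k. 2 * (real (k + 1) * norm (u k)) + norm (u k)) sums
          (2 * (\<Sum>k. real (k + 1) * norm (u k)) + (\<Sum>k. norm (u k)))"
        using nsm[of 0] nsm[of 1] by (intro sums_add sums_mult summable_sums) simp_all
      also have "(\<lambda>k. 2 * (real (k + 1) * norm (u k)) + norm (u k)) = (\<lambda>k. (2 * real k + 3) * norm (u k))"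
        by (simp add: algebra_simps)
      finally have "2 * norm (deriv q z) + norm (s z) \<le> 1"
        using 0 1 le by (simp add: sums_iff)
      then have "norm z * (2 * norm (deriv q z) + norm (s z)) \<le> norm z"
        by (rule mult_left_le) simp
      with z show ?thesis by (simp add: q_def norm_mult algebra_simps)
    qed
  qed
qed

subsection \<open>Mapping \<open>R(\<beta>)\<close> into \<open>S\<^sub>p\<close>\<close>

lemma norm_pochhammer_le: "norm (pochhammer a n) \<le> pochhammer (norm a) n"
  for a :: "'a :: {real_normed_field}"
proof -
  have "norm (a + of_nat i) \<le> norm a + real i" for i
    using norm_triangle_ineq[of a "of_nat i"] by simp
  then show ?thesis
    by (simp add: pochhammer_prod prod_norm[symmetric] prod_mono)
qed

text \<open>Both \<open>b * pochhammer (b + 1) n\<close> and \<open>pochhammer b n * (b + n)\<close>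
  equal \<open>pochhammer b (n + 1)\<close>. This simplifies the factors with b and c in the
  coefficients of the operator.\<close>

lemma pochhammer_plus1_quotient:
  fixes b :: "'a :: field_char_0"
  assumes "pochhammer (b + 1) n \<noteq> 0" "b + of_nat n \<noteq> 0"
  shows "pochhammer b n / pochhammer (b + 1) n = b / (b + of_nat n)"
  using pochhammer_rec[of b n] pochhammer_rec'[of b n] assms by (simp add: divide_simps mult_ac)

theorem theorem5p2:
  fixes a :: complex and b c \<beta> :: real
  assumes "a \<noteq> 0" and "b > 0" and "c > 0"
    and "cmod a \<noteq> 1" and "b \<noteq> 1" and "c \<noteq> 1" and "b \<noteq> c"
    and "b > cmod a - 1" and "c > cmod a - 1"
    and "cmod a < 2"
    and "\<beta> < 1"
    and "b * c / (c - b) * Gamma (1 - cmod a) *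
           ((2 * b - 1) / (b - 1) * (Gamma b / Gamma (1 - cmod a + b))
            - (2 * c - 1) / (c - 1) * (Gamma c / Gamma (1 - cmod a + c)))
         + b * c / ((cmod a - 1) * (b - 1) * (c - 1))
         \<le> 1 / (2 * (1 - \<beta>)) + 1"
  shows "\<forall>f \<in> class_R \<beta>. I_op a (of_real b) (of_real c) f \<in> class_Sp"
proof
  fix f assume f: "f \<in> class_R \<beta>"
  define \<alpha> where "\<alpha> = cmod a"
  define t where "t = (\<lambda>k. (2 * real k + 1) / (real k + 1) *
    (pochhammer \<alpha> k / fact k * (b * c / ((b + real k) * (c + real k)))))"
  define u where "u = (\<lambda>n. (pochhammer a (n+1) * pochhammer (of_real b) (n+1) * pochhammer (of_real c) (n+1)) /
     (pochhammer (of_real b+1) (n+1) * pochhammer (of_real c+1) (n+1) * pochhammer 1 (n+1))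
     * taylor_coeff f (n+2))"
  obtain L where L: "t sums L" "L \<le> 1 / (2 * (1 - \<beta>)) + 1"
    using pochhammer_weighted_sums[of \<alpha> b c] assms unfolding t_def \<alpha>_def by auto
  have "t 0 = 1" using assms by (simp add: t_def)
  with L(1) have "(\<lambda>k. t (Suc k)) sums (L - 1)" by (simp add: sums_Suc_iff)
  then have T: "(\<lambda>k. 2 * (1 - \<beta>) * t (Suc k)) sums (2 * (1 - \<beta>) * (L - 1))" by (rule sums_mult)
  have quot: "norm (pochhammer (of_real x) n / pochhammer (of_real x + 1) n :: complex) = x / (x + real n)"
    if "x > 0" for x n
  proof -
    have "(pochhammer (of_real x) n / pochhammer (of_real x + 1) n :: complex) = of_real (pochhammer x n / pochhammer (x + 1) n)"
      by (simp flip: pochhammer_of_real)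
    also have "pochhammer x n / pochhammer (x + 1) n = x / (x + real n)"
      using that pochhammer_pos[of "x + 1" n] by (intro pochhammer_plus1_quotient) auto
    finally show ?thesis using that by (simp only: norm_of_real) simp
  qed
  \<comment> \<open>The index of \<open>t\<close> is one ahead of that of \<open>u\<close>: in
    \<open>t (Suc k)\<close> the numerator 2 k + 3 is the criterion's weight, and the denominator k
    + 2 comes from the coefficient bound for degree k + 2.\<close>
  have bound: "(2 * real k + 3) * norm (u k) \<le> 2 * (1 - \<beta>) * t (Suc k)" for k
  proof -
    let ?n = "Suc k"
    have "u k = pochhammer a ?n / fact ?n * (pochhammer (of_real b) ?n / pochhammer (of_real b + 1) ?n)
        * (pochhammer (of_real c) ?n / pochhammer (of_real c + 1) ?n) * taylor_coeff f (Suc ?n)"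
      by (simp add: u_def pochhammer_fact del: pochhammer_Suc fact_Suc)
    then have "norm (u k) = norm (pochhammer a ?n) / fact ?n * (b / (b + real ?n)) * (c / (c + real ?n))
        * norm (taylor_coeff f (Suc ?n))"
      by (simp only: norm_mult norm_divide[of _ "fact _"] norm_fact quot[OF \<open>b > 0\<close>] quot[OF \<open>c > 0\<close>])
    also have "\<dots> \<le> pochhammer \<alpha> ?n / fact ?n * (b / (b + real ?n)) * (c / (c + real ?n)) * (2 * (1 - \<beta>) / (real ?n + 1))"
      using assms class_R_coeff_bound[OF f \<open>\<beta> < 1\<close>, of ?n]
      by (intro mult_mono divide_right_mono norm_pochhammer_le[of a, folded \<alpha>_def] order_refl)
         (auto simp: \<alpha>_def pochhammer_nonneg add.commute simp del: pochhammer_Suc)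
    finally have "(2 * real k + 3) * norm (u k) \<le> (2 * real k + 3) *
       (pochhammer \<alpha> ?n / fact ?n * (b / (b + real ?n)) * (c / (c + real ?n)) * (2 * (1 - \<beta>) / (real ?n + 1)))"
      by (rule mult_left_mono) simp
    also have "\<dots> = 2 * (1 - \<beta>) * t ?n"
      by (simp add: t_def mult_ac del: pochhammer_Suc fact_Suc)
    finally show ?thesis .
  qed
  have sm: "summable (\<lambda>k. (2 * real k + 3) * norm (u k))"
    by (rule summable_comparison_test'[OF sums_summable[OF T], of 0]) (use bound in simp)
  show "I_op a (of_real b) (of_real c) f \<in> class_Sp"
  proof (rule class_Sp_if_coeff_sum_le[OF sm])
    have "(\<Sum>k. (2 * real k + 3) * norm (u k)) \<le> 2 * (1 - \<beta>) * (L - 1)"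
      using suminf_le[OF bound sm sums_summable[OF T]] sums_unique[OF T] by simp
    also have "\<dots> \<le> 2 * (1 - \<beta>) * (1 / (2 * (1 - \<beta>)))"
      using L(2) \<open>\<beta> < 1\<close> by (intro mult_left_mono) auto
    also have "\<dots> = 1" using \<open>\<beta> < 1\<close> by simp
    finally show "(\<Sum>k. (2 * real k + 3) * norm (u k)) \<le> 1" .
    show "I_op a (of_real b) (of_real c) f z = z + (\<Sum>k. u k * z ^ (k + 2))" for z
      unfolding I_op_def u_def ..
  qed
qed

end
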